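(* Let $n\ge 1$ be an integer, let $U$ be a finite set (the universe) with real weights $(w_u)_{u\in U}$, $w_u\ge 0$, and let $U_i\subseteq U$ for each $i\in[n]=\{1,\dots,n\}$. Define the weighted coverage (set cover) function $f:2^{[n]}\to\mathbb{R}_{\ge 0}$ by $$f(A)=\sum_{u\in \bigcup_{i\in A} U_i} w_u,\qquad A\subseteq[n].$$ Then $f$ is entropic.
   Context: A set function $f:2^{[n]}\to\mathbb{R}_{\ge 0}$ is called entropic if there exist jointly distributed (discrete) random variables $X_1,\dots,X_n$ such that $f(A)=H(X_A)$ for all $A\subseteq[n]$, where $X_A=(X_i)_{i\in A}$ and $H$ denotes (joint) Shannon entropy, with $H(X_\emptyset)=0$. *)

theory Defs
  imports "HOL-Probability.Probability"
begin

definition joint :: "(nat \<Rightarrow> 's \<Rightarrow> 'v) \<Rightarrow> nat set \<Rightarrow> 's \<Rightarrow> (nat \<Rightarrow> 'v)" where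
  "joint X A = (\<lambda>\<omega>. \<lambda>i\<in>A. X i \<omega>)"

(* The library entropy is a Bochner integral, which is 0 by convention if it diverges.
   The conjunct finite_entropy excludes this: it asks that the probability mass function of
   the joint variable is its density w.r.t. counting measure and that p * log p is summable. *)
definition (in information_space) entropy_realized_by ::
  "nat \<Rightarrow> (nat set \<Rightarrow> real) \<Rightarrow> (nat \<Rightarrow> 'a \<Rightarrow> 'v) \<Rightarrow> bool" where
  "entropy_realized_by n f X \<longleftrightarrow>
     (\<forall>i\<in>{1..n}. X i \<in> measurable M (count_space UNIV)) \<and>
     (\<forall>A\<subseteq>{1..n}.
        finite_entropy (count_space (joint X A ` space M)) (joint X A)
          (\<lambda>x. prob {\<omega> \<in> space M. joint X A \<omega> = x}) \<and>
        f A = \<H>(joint X A))"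

(* b is the base of the logarithm.  A discrete random variable takes countably many values, so
   they may be coded as naturals; the sample space may then be taken to be the space of value
   tuples, which is why it is existentially quantified at type nat => nat. *)
definition entropic :: "real \<Rightarrow> nat \<Rightarrow> (nat set \<Rightarrow> real) \<Rightarrow> bool" where
  "entropic b n f \<longleftrightarrow>
     (\<exists>(M :: (nat \<Rightarrow> nat) measure) (X :: nat \<Rightarrow> (nat \<Rightarrow> nat) \<Rightarrow> nat).
        information_space M b \<and> information_space.entropy_realized_by M b n f X)"

definition weighted_coverage :: "('u \<Rightarrow> real) \<Rightarrow> (nat \<Rightarrow> 'u set) \<Rightarrow> nat set \<Rightarrow> real" where
  "weighted_coverage w V A = (\<Sum>u\<in>(\<Union>i\<in>A. V i). w u)"

end

(* Attach to each u in U an independent finite random variable Z_u with entropy w_u, and let X_i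
   be the tuple of all Z_u with u in U_i.  Then X_A determines, and is determined by, the Z_u with u
   in the union of the U_i over A, so by independence its entropy is the sum of their weights. *)

theory Submission
  imports Defs "HOL-Real_Asymp.Real_Asymp"
begin

text \<open>The contribution of a probability x to Shannon entropy. The factor x makes its value at
  0 equal to 0, as in the convention 0 log 0 = 0.\<close>

definition eta :: "real \<Rightarrow> real \<Rightarrow> real" where
  "eta b x = - x * log b x"

text \<open>A Leibniz rule: the logarithm turns products into sums, and both sides vanish when a
  factor is 0. It is the source of additivity of entropy over independent factors.\<close>

lemma eta_mult: "eta b (x * y) = x * eta b y + y * eta b x"
  by (cases "x = 0 \<or> y = 0") (auto simp: eta_def log_mult algebra_simps)

lemma continuous_on_eta:
  assumes "b > 1"
  shows "continuous_on {0..} (eta b)"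
  unfolding continuous_on_eq_continuous_within
proof
  fix x :: real assume "x \<in> {0..}"
  \<comment> \<open>Only the boundary point 0 is delicate: there the limit must agree with the value
    \<open>eta b 0\<close> = 0.\<close>
  have "((\<lambda>x. x * ln x) \<longlongrightarrow> 0) (at_right (0::real))"
    by real_asymp
  then have 0: "((\<lambda>x. - (x * ln x) / ln b) \<longlongrightarrow> - 0 / ln b) (at_right 0)"
    unfolding divide_inverse by (intro tendsto_intros)
  show "continuous (at x within {0..}) (eta b)"
  proof (cases "x = 0")
    case True
    with 0 show ?thesis
      by (simp add: continuous_within at_within_Ici_at_right eta_def[abs_def] log_def)
  next
    case False
    with \<open>x \<in> {0..}\<close> have "x > 0" by simp
    then show ?thesis
      unfolding eta_def log_def using assms by (auto intro!: continuous_intros)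
  qed
qed

lemma exists_distribution_of_entropy:
  fixes b w :: real
  assumes "b > 1" "w \<ge> 0"
  obtains N :: nat and p :: "nat \<Rightarrow> real"
  where "\<And>k. p k \<ge> 0" "(\<Sum>k<N. p k) = 1" "(\<Sum>k<N. eta b (p k)) = w"
proof -
  \<comment> \<open>Rounding up gives N \<ge> b^w, hence log N \<ge> w. The successor separates the
    point 0 from n points that share one weight.\<close>
  define n where "n = nat \<lceil>b powr w\<rceil>"
  define N where "N = Suc n"
  \<comment> \<open>A segment of distributions on N points, from a point mass (entropy 0) to the uniform one
    (entropy log N, at least w); the intermediate value theorem applies.\<close>
  define p where "p t k = (if k = 0 then 1 - t + t / N else t / N)" for t and k :: nat
  have nonneg: "p t k \<ge> 0" if "0 \<le> t" "t \<le> 1" for t k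
    using that by (simp add: p_def)
  \<comment> \<open>\<open>F\<close> is arbitrary because two sums are needed: \<open>eta b\<close>
    gives the entropy and the identity gives the total mass.\<close>
  have sum_p: "(\<Sum>k<N. F (p t k)) = F (1 - t + t / N) + n * F (t / N)" for F :: "real \<Rightarrow> real" and t
    unfolding N_def sum.lessThan_Suc_shift by (simp add: p_def N_def)
  have "\<exists>t\<ge>0. t \<le> 1 \<and> (\<Sum>k<N. eta b (p t k)) = w"
  proof (rule IVT')
    show "(\<Sum>k<N. eta b (p 0 k)) \<le> w"
      unfolding sum_p using assms by (simp add: eta_def)
    have "b powr w \<le> real N"
      unfolding N_def n_def by linarith
    then have "w \<le> log b N"
      using assms by (simp add: le_log_iff N_def)
    also have "\<dots> = (1 + real n) * (log b N / N)"
      by (simp add: N_def)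
    also have "\<dots> = (\<Sum>k<N. eta b (p 1 k))"
      unfolding sum_p using assms by (simp add: eta_def log_divide distrib_right add_divide_distrib N_def)
    finally show "w \<le> (\<Sum>k<N. eta b (p 1 k))" .
    show "continuous_on {0..1} (\<lambda>t. \<Sum>k<N. eta b (p t k))"
      unfolding sum_p
      by (intro continuous_intros continuous_on_compose2[OF continuous_on_eta[OF \<open>b > 1\<close>]]) (auto simp: N_def)
  qed simp
  then obtain t where "0 \<le> t" "t \<le> 1" "(\<Sum>k<N. eta b (p t k)) = w"
    by blast
  moreover have "(\<Sum>k<N. p t k) = 1"
  proof -
    have "(1 + real n) * (t / N) = t"
      by (simp add: N_def)
    then show ?thesis
      using sum_p[of "\<lambda>x. x" t] by (simp add: distrib_right add_divide_distrib)
  qed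
  ultimately show ?thesis
    using that[of "p t" N] nonneg by blast
qed

text \<open>Entropy of a product distribution, one coordinate at a time: \<open>eta_mult\<close>
  splits off the new factor, and each of the two resulting terms is multiplied by a total mass,
  which is 1.\<close>

lemma sum_PiE_eta_prod:
  fixes p :: "'i \<Rightarrow> 'v \<Rightarrow> real"
  assumes "finite W" "\<And>k. k \<in> W \<Longrightarrow> finite (S k)" "\<And>k. k \<in> W \<Longrightarrow> (\<Sum>y\<in>S k. p k y) = 1"
  shows "(\<Sum>x\<in>PiE W S. eta b (\<Prod>k\<in>W. p k (x k))) = (\<Sum>k\<in>W. \<Sum>y\<in>S k. eta b (p k y))"
  using assms
proof (induction W)
  case empty
  then show ?case by (simp add: eta_def)
next
  case (insert j W)
  have total: "(\<Sum>x\<in>PiE W S. \<Prod>k\<in>W. p k (x k)) = 1"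
    using insert.prems insert.hyps by (subst prod_sum_PiE[symmetric]) auto
  have upd: "(\<Prod>k\<in>insert j W. p k ((x(j := y)) k)) = p j y * (\<Prod>k\<in>W. p k (x k))" for x y
    using insert.hyps by (auto intro!: prod.cong)
  have "(\<Sum>x\<in>PiE (insert j W) S. eta b (\<Prod>k\<in>insert j W. p k (x k))) =
    (\<Sum>(y, x)\<in>S j \<times> PiE W S. eta b (p j y * (\<Prod>k\<in>W. p k (x k))))"
    unfolding PiE_insert_eq using insert.hyps
    by (subst sum.reindex[OF inj_combinator])
       (auto simp: upd simp del: prod.insert fun_upd_apply intro!: sum.cong)
  also have "\<dots> = (\<Sum>y\<in>S j. \<Sum>x\<in>PiE W S. p j y * eta b (\<Prod>k\<in>W. p k (x k)) + (\<Prod>k\<in>W. p k (x k)) * eta b (p j y))"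
    by (simp add: sum.cartesian_product[symmetric] eta_mult)
  also have "\<dots> = (\<Sum>y\<in>S j. p j y * (\<Sum>x\<in>PiE W S. eta b (\<Prod>k\<in>W. p k (x k))) + eta b (p j y))"
    by (simp add: sum.distrib sum_distrib_left[symmetric] sum_distrib_right[symmetric] total)
  also have "\<dots> = (\<Sum>x\<in>PiE W S. eta b (\<Prod>k\<in>W. p k (x k))) + (\<Sum>y\<in>S j. eta b (p j y))"
    using insert.prems by (simp add: sum.distrib sum_distrib_right[symmetric])
  finally show ?case
    using insert by simp
qed

text \<open>Coordinate k of a sample point plays the role of a random variable with law
  \<open>p k\<close> on \<open>S k\<close>. Independence is built in, since sample points carry
  product weights.\<close>

locale finite_product_distribution =
  fixes b :: real and I :: "'i set" and S :: "'i \<Rightarrow> 'v set" and p :: "'i \<Rightarrow> 'v \<Rightarrow> real"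
  assumes base: "b > 1"
    and finite_I: "finite I" and finite_S: "\<And>k. k \<in> I \<Longrightarrow> finite (S k)"
    and nonneg: "\<And>k y. k \<in> I \<Longrightarrow> p k y \<ge> 0"
    and total: "\<And>k. k \<in> I \<Longrightarrow> (\<Sum>y\<in>S k. p k y) = 1"
begin

definition M :: "('i \<Rightarrow> 'v) measure" where
  "M = point_measure (PiE I S) (\<lambda>\<omega>. \<Prod>k\<in>I. p k (\<omega> k))"

lemma finite_PiE_S: "finite (PiE I S)"
  using finite_I finite_S by (rule finite_PiE)

lemma space_M: "space M = PiE I S"
  by (simp add: M_def space_point_measure)

lemma weight_nonneg: "(\<Prod>k\<in>I. p k (\<omega> k)) \<ge> 0"
  by (intro prod_nonneg) (simp add: nonneg)

lemma prob_space_M: "prob_space M"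
  unfolding M_def
proof (rule prob_space_point_measure)
  have "(\<Sum>\<omega>\<in>PiE I S. ennreal (\<Prod>k\<in>I. p k (\<omega> k))) = ennreal (\<Sum>\<omega>\<in>PiE I S. \<Prod>k\<in>I. p k (\<omega> k))"
    by (simp add: weight_nonneg)
  also have "(\<Sum>\<omega>\<in>PiE I S. \<Prod>k\<in>I. p k (\<omega> k)) = 1"
    using finite_I finite_S by (subst prod_sum_PiE[symmetric]) (auto simp: total)
  finally show "(\<Sum>\<omega>\<in>PiE I S. ennreal (\<Prod>k\<in>I. p k (\<omega> k))) = 1" by simp
qed (auto simp: finite_PiE_S)

sublocale information_space M b
  using prob_space_M base
  by (simp add: information_space_def information_space_axioms_def)

lemma simple_function_M: "simple_function M X"
  by (simp add: M_def finite_PiE_S)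

text \<open>The event is a box: coordinates in \<open>W\<close> are fixed by \<open>x\<close>, the
  others are free. Its weight factorises, and each free coordinate sums to 1.\<close>

lemma prob_restrict:
  assumes "W \<subseteq> I" "x \<in> PiE W S"
  shows "prob ((\<lambda>\<omega>. restrict \<omega> W) -` {x} \<inter> space M) = (\<Prod>k\<in>W. p k (x k))"
proof -
  define T where "T k = (if k \<in> W then {x k} else S k)" for k
  have "restrict \<omega> W = x \<longleftrightarrow> (\<forall>k\<in>W. \<omega> k = x k)" for \<omega>
    using assms(2) by (metis PiE_restrict restrict_apply' restrict_ext)
  then have "(\<lambda>\<omega>. restrict \<omega> W) -` {x} \<inter> space M = PiE I T"
    using assms by (auto simp: space_M T_def PiE_iff split: if_splits; blast)
  moreover have "PiE I T \<subseteq> PiE I S"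
    using assms by (auto simp: T_def intro!: PiE_mono split: if_splits)
  ultimately have "prob ((\<lambda>\<omega>. restrict \<omega> W) -` {x} \<inter> space M) = (\<Sum>\<omega>\<in>PiE I T. \<Prod>k\<in>I. p k (\<omega> k))"
    by (simp add: M_def measure_def emeasure_point_measure_finite finite_PiE_S weight_nonneg
        sum_nonneg)
  also have "\<dots> = (\<Prod>k\<in>I. \<Sum>y\<in>T k. p k y)"
    using finite_I finite_S by (subst prod_sum_PiE) (auto simp: T_def)
  also have "\<dots> = (\<Prod>k\<in>I. if k \<in> W then p k (x k) else 1)"
    by (intro prod.cong) (auto simp: T_def total)
  also have "\<dots> = (\<Prod>k\<in>W. p k (x k))"
    using assms finite_I by (simp add: prod.If_cases Int_absorb1)
  finally show ?thesis .
qed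

text \<open>By \<open>prob_restrict\<close> the marginal on \<open>W\<close> is again a product
  distribution, so \<open>sum_PiE_eta_prod\<close> evaluates its entropy.\<close>

lemma entropy_restrict:
  assumes "W \<subseteq> I"
  shows "entropy_Pow (\<lambda>\<omega>. restrict \<omega> W) = (\<Sum>k\<in>W. \<Sum>y\<in>S k. eta b (p k y))"
proof -
  \<comment> \<open>An empty \<open>S k\<close> would have mass 0 instead of 1. Nonemptiness lets
    every point of \<open>PiE W S\<close> extend to a sample point, so the sum over the image runs
    over all of \<open>PiE W S\<close>.\<close>
  have nonempty: "S k \<noteq> {}" if "k \<in> I" for k
    using total[OF that] by auto
  have image: "(\<lambda>\<omega>. restrict \<omega> W) ` space M = PiE W S"
  proof (intro equalityI subsetI)
    fix x assume "x \<in> (\<lambda>\<omega>. restrict \<omega> W) ` space M"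
    then show "x \<in> PiE W S"
      using assms by (auto simp: space_M)
  next
    fix x assume x: "x \<in> PiE W S"
    define \<omega> where "\<omega> = (\<lambda>k\<in>I. if k \<in> W then x k else (SOME y. y \<in> S k))"
    have "\<omega> \<in> space M"
      using x nonempty by (auto simp: \<omega>_def space_M some_in_eq)
    moreover have "x = restrict \<omega> W"
      using x assms by (auto simp: \<omega>_def fun_eq_iff PiE_iff extensional_def restrict_def)
    ultimately show "x \<in> (\<lambda>\<omega>. restrict \<omega> W) ` space M"
      by blast
  qed
  have fin: "finite W"
    using assms finite_I by (rule finite_subset)
  have "entropy_Pow (\<lambda>\<omega>. restrict \<omega> W) = (\<Sum>x\<in>PiE W S. eta b (\<Prod>k\<in>W. p k (x k)))"
    using entropy_simple_distributed[OF simple_distributedI[OF simple_function_M measure_nonneg refl],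
        of "\<lambda>\<omega>. restrict \<omega> W"]
    by (simp add: image prob_restrict[OF assms] eta_def sum_negf)
  also have "\<dots> = (\<Sum>k\<in>W. \<Sum>y\<in>S k. eta b (p k y))"
    using fin assms finite_S total by (intro sum_PiE_eta_prod) auto
  finally show ?thesis .
qed

end

theorem theorem1:
  fixes n :: nat and b :: real and U :: "'u set" and w :: "'u \<Rightarrow> real" and V :: "nat \<Rightarrow> 'u set"
  assumes "n \<ge> 1"
    and "b > 1"
    and "finite U"
    and "\<And>u. u \<in> U \<Longrightarrow> w u \<ge> 0"
    and "\<And>i. i \<in> {1..n} \<Longrightarrow> V i \<subseteq> U"
  shows "entropic b n (weighted_coverage w V)"
proof -
  \<comment> \<open>Elements of \<open>U\<close> are numbered so that sample points have the type
    \<open>nat \<Rightarrow> nat\<close> required by \<open>entropic\<close>.\<close>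
  obtain e where e: "bij_betw e {..<card U} U"
    using ex_bij_betw_nat_finite[OF \<open>finite U\<close>] by (auto simp: atLeast0LessThan)
  define I where "I = {..<card U}"
  have e_U: "e k \<in> U" if "k \<in> I" for k
    using e that by (auto simp: I_def bij_betw_def)
  define Q :: "nat \<Rightarrow> nat \<Rightarrow> (nat \<Rightarrow> real) \<Rightarrow> bool" where "Q k N p \<longleftrightarrow>
    (\<forall>y. p y \<ge> 0) \<and> (\<Sum>y<N. p y) = 1 \<and> (\<Sum>y<N. eta b (p y)) = w (e k)" for k N p
  have "\<exists>N p. Q k N p" if "k \<in> I" for k
    unfolding Q_def
    by (rule exists_distribution_of_entropy[OF \<open>b > 1\<close> assms(4)[OF e_U[OF that]]]) blast
  then obtain N p where "\<And>k. k \<in> I \<Longrightarrow> Q k (N k) (p k)"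
    by metis
  then have p: "\<And>k y. k \<in> I \<Longrightarrow> p k y \<ge> 0" "\<And>k. k \<in> I \<Longrightarrow> (\<Sum>y<N k. p k y) = 1"
      "\<And>k. k \<in> I \<Longrightarrow> (\<Sum>y<N k. eta b (p k y)) = w (e k)"
    by (simp_all add: Q_def)
  interpret finite_product_distribution b I "\<lambda>k. {..<N k}" p
    using \<open>b > 1\<close> p by unfold_locales (auto simp: I_def)
  define W where "W i = {k\<in>I. e k \<in> V i}" for i
  \<comment> \<open>The tuple of coordinates in \<open>W i\<close>, listed in increasing order and
    coded injectively as one natural number.\<close>
  define X where "X i \<omega> = to_nat (map \<omega> (sorted_list_of_set (W i)))" for i and \<omega> :: "nat \<Rightarrow> nat"
  have X_eq_iff: "X i \<omega> = X i \<omega>' \<longleftrightarrow> (\<forall>k\<in>W i. \<omega> k = \<omega>' k)" for i \<omega> \<omega>'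
    using finite_I by (simp add: X_def W_def)
  have "weighted_coverage w V A = entropy_Pow (joint X A)" if "A \<subseteq> {1..n}" for A
  proof -
    define C where "C = (\<Union>i\<in>A. W i)"
    have "C \<subseteq> I"
      by (auto simp: C_def W_def)
    have "joint X A (restrict \<omega> C) = joint X A \<omega>" for \<omega>
      by (auto simp: joint_def fun_eq_iff X_eq_iff C_def)
    \<comment> \<open>\<open>joint X A\<close> is a function of the coordinates in \<open>C\<close>,
      and the next step shows that this function is injective on their possible values; hence the
      entropies agree.\<close>
    then have joint_eq: "joint X A = joint X A \<circ> (\<lambda>\<omega>. restrict \<omega> C)"
      by (simp add: fun_eq_iff)
    have "inj_on (joint X A) ((\<lambda>\<omega>. restrict \<omega> C) ` space M)"
    proof (intro inj_onI)
      fix x y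
      assume x: "x \<in> (\<lambda>\<omega>. restrict \<omega> C) ` space M" and y: "y \<in> (\<lambda>\<omega>. restrict \<omega> C) ` space M"
        and eq: "joint X A x = joint X A y"
      have "X i x = X i y" if "i \<in> A" for i
        using fun_cong[OF eq, of i] that by (simp add: joint_def)
      then have "x k = y k" if "k \<in> C" for k
        using that by (auto simp: X_eq_iff C_def)
      then show "x = y"
        using x y by (auto intro: extensionalityI)
    qed
    then have "entropy_Pow (joint X A \<circ> (\<lambda>\<omega>. restrict \<omega> C)) = entropy_Pow (\<lambda>\<omega>. restrict \<omega> C)"
      by (rule entropy_of_inj[OF simple_function_M])
    then have "entropy_Pow (joint X A) = entropy_Pow (\<lambda>\<omega>. restrict \<omega> C)"
      by (fold joint_eq)
    also have "\<dots> = (\<Sum>k\<in>C. w (e k))"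
      using \<open>C \<subseteq> I\<close> p(3) by (auto simp: entropy_restrict intro!: sum.cong)
    \<comment> \<open>As \<open>e\<close> is injective, each element of the union is counted once,
      even if several \<open>V i\<close> contain it.\<close>
    also have "\<dots> = (\<Sum>u\<in>e ` C. w u)"
      using e \<open>C \<subseteq> I\<close> by (subst sum.reindex) (auto simp: I_def bij_betw_def intro: inj_on_subset)
    also have "e ` C = (\<Union>i\<in>A. V i)"
    proof (intro equalityI subsetI)
      fix u assume u: "u \<in> (\<Union>i\<in>A. V i)"
      then have "u \<in> U"
        using that assms(5) by blast
      then obtain k where "k \<in> I" "u = e k"
        using e by (auto simp: I_def bij_betw_def)
      with u show "u \<in> e ` C"
        by (auto simp: C_def W_def)
    qed (auto simp: C_def W_def)
    finally show ?thesis
      by (simp add: weighted_coverage_def)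
  qed
  moreover have "X i \<in> measurable M (count_space UNIV)" for i
    by (simp add: M_def)
  ultimately have "entropy_realized_by n (weighted_coverage w V) X"
    \<comment> \<open>The sample space is finite, so every function on it is simple and the
      \<open>finite_entropy\<close> conjunct holds.\<close>
    by (simp add: entropy_realized_by_def finite_entropy_simple_function simple_function_M)
  then show ?thesis
    unfolding entropic_def using information_space_axioms by blast
qed

end
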